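(* Let $(\mu_n)_{n\in\mathbb{N}_0}$ be a sequence of measures on $(X,\mathfrak{B})$ satisfying $\mu_{n+1}\circ r^{-1}=\mu_n$ for all $n\in\mathbb{N}_0$, and let $\hat\mu$ be the associated measure on $(X_\infty(r),\mathfrak{B}_\infty)$, i.e. the measure determined by $\hat\mu\circ\theta_n^{-1}=\mu_n$ for all $n\in\mathbb{N}_0$. Let $V\colon X\to[0,\infty)$ be $\mathfrak{B}$-measurable. Then $$\hat\mu\circ\hat r\ll\hat\mu\quad\text{and}\quad\frac{d(\hat\mu\circ\hat r)}{d\hat\mu}=V\circ\theta_0\quad\hat\mu\text{-a.e. on }(X_\infty(r),\mathfrak{B}_\infty)$$ if and only if $$d\mu_0=(V\,d\mu_0)\circ r^{-1},\quad\text{and}\quad d\mu_{n+1}=(V\circ r^n)\,d\mu_n\quad(n\in\mathbb{N}_0),$$ or, equivalently, if and only if $$\int_Xf\,d\mu_0=\int_X (f\circ r)\,V\,d\mu_0,\quad\text{and}\quad\int_Xf\,d\mu_{n+1}=\int_Xf\,(V\circ r^n)\,d\mu_n\quad(n\in\mathbb{N}_0)$$ for all bounded $\mathfrak{B}$-measurable functions $f$ on $X$.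
   Context: $X$ is a compact Hausdorff space, $\mathfrak{B}$ is its Borel $\sigma$-algebra, and $r\colon X\to X$ is a $\mathfrak{B}$-measurable map that is onto and finite-to-one, i.e. $1\le\#r^{-1}(x)<\infty$ for all $x\in X$, and not invertible, i.e. $\#r^{-1}(x)$ is not identically $1$. $r^n$ denotes the $n$-fold composition of $r$ with itself ($r^0=\mathrm{id}$), and $\mathbb{N}_0=\{0,1,2,\dots\}$. The projective limit is $X_\infty(r)=\{\hat x=(x_0,x_1,\dots)\in\prod_{n\in\mathbb{N}_0}X : r(x_{n+1})=x_n \text{ for all } n\in\mathbb{N}_0\}$, with coordinate maps $\theta_n\colon X_\infty(r)\to X$, $\theta_n(\hat x)=x_n$. The map $\hat r\colon X_\infty(r)\to X_\infty(r)$, $\hat r(x_0,x_1,x_2,\dots)=(r(x_0),x_0,x_1,\dots)$, is a bijection with inverse $\hat r^{-1}(x_0,x_1,\dots)=(x_1,x_2,\dots)$. $\mathfrak{B}_n=\theta_n^{-1}(\mathfrak{B})$ is an increasing sequence of $\sigma$-algebras, and $\mathfrak{B}_\infty$ is the $\sigma$-algebra generated by $\bigcup_n\mathfrak{B}_n$; $\hat r$ and $\hat r^{-1}$ are $\mathfrak{B}_\infty$-measurable. All measures are positive and finite. $\mu\circ r^{-1}$ is the measure $E\mapsto\mu(r^{-1}(E))$, $\hat\mu\circ\theta_n^{-1}$ is the measure $E\mapsto\hat\mu(\theta_n^{-1}(E))$, and $(\hat\mu\circ\hat r)(E)=\hat\mu(\hat r(E))$. $V\,d\mu_0$ is the measure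 with density $V$ with respect to $\mu_0$, so $(V\,d\mu_0)\circ r^{-1}$ is the measure $E\mapsto\int_{r^{-1}(E)}V\,d\mu_0$. *)

theory Defs
  imports "HOL-Analysis.Analysis"
begin

definition proj_limit :: "('a \<Rightarrow> 'a) \<Rightarrow> (nat \<Rightarrow> 'a) set" where
  "proj_limit r = {x. \<forall>n. r (x (Suc n)) = x n}"

definition theta :: "nat \<Rightarrow> (nat \<Rightarrow> 'a) \<Rightarrow> 'a" where
  "theta n x = x n"

definition rhat :: "('a \<Rightarrow> 'a) \<Rightarrow> (nat \<Rightarrow> 'a) \<Rightarrow> (nat \<Rightarrow> 'a)" where
  "rhat r x = case_nat (r (x 0)) x"

definition B_level :: "('a::topological_space \<Rightarrow> 'a) \<Rightarrow> nat \<Rightarrow> (nat \<Rightarrow> 'a) set set" where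
  "B_level r n = {theta n -` A \<inter> proj_limit r | A. A \<in> sets borel}"

text \<open>A measurable space in the library's sense: only its carrier and its \<open>\<sigma>\<close>-algebra
  matter, the measure attached to it is zero.\<close>

definition B_infty :: "('a::topological_space \<Rightarrow> 'a) \<Rightarrow> (nat \<Rightarrow> 'a) measure" where
  "B_infty r = sigma (proj_limit r) (\<Union>n. B_level r n)"

text \<open>The measure \<open>E \<mapsto> M (rhat r ` E)\<close>.  As \<open>measure_of\<close> silently yields
  the zero measure when its argument is not countably additive, lemma
  \<open>emeasure_rhat_pullback\<close> below confirms that this does not happen.\<close>

definition rhat_pullback ::
    "('a \<Rightarrow> 'a) \<Rightarrow> (nat \<Rightarrow> 'a) measure \<Rightarrow> (nat \<Rightarrow> 'a) measure" where
  "rhat_pullback r M = measure_of (space M) (sets M) (\<lambda>E. emeasure M (rhat r ` E))"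

lemma space_B_infty [simp]: "space (B_infty r) = proj_limit r"
  unfolding B_infty_def by (rule space_measure_of) (auto simp: B_level_def)

lemma sets_B_infty: "sets (B_infty r) = sigma_sets (proj_limit r) (\<Union>n. B_level r n)"
  unfolding B_infty_def by (rule sets_measure_of) (auto simp: B_level_def)

lemma measurable_theta: "theta n \<in> measurable (B_infty r) borel"
proof (rule measurableI)
  fix A :: "'a set" assume "A \<in> sets borel"
  then have "theta n -` A \<inter> proj_limit r \<in> (\<Union>n. B_level r n)"
    by (auto simp: B_level_def)
  then show "theta n -` A \<inter> space (B_infty r) \<in> sets (B_infty r)"
    by (auto simp: sets_B_infty)
qed auto

lemma rhat_image_eq:
  assumes "E \<subseteq> proj_limit r"
  shows "rhat r ` E = (\<lambda>x. x \<circ> Suc) -` E \<inter> proj_limit r"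
proof (intro equalityI subsetI)
  fix y assume "y \<in> rhat r ` E"
  then obtain x where x: "x \<in> E" "y = rhat r x" by auto
  have "y \<circ> Suc = x" by (auto simp: x rhat_def)
  moreover have "y \<in> proj_limit r"
    using x assms by (auto simp: proj_limit_def rhat_def split: nat.splits)
  ultimately show "y \<in> (\<lambda>x. x \<circ> Suc) -` E \<inter> proj_limit r" using x by auto
next
  fix y assume y: "y \<in> (\<lambda>x. x \<circ> Suc) -` E \<inter> proj_limit r"
  then have "y = rhat r (y \<circ> Suc)"
    by (auto simp: rhat_def proj_limit_def fun_eq_iff split: nat.splits)
  then show "y \<in> rhat r ` E" using y by blast
qed

lemma measurable_shift: "(\<lambda>x. x \<circ> Suc) \<in> measurable (B_infty r) (B_infty r)"
proof (rule measurable_sigma_sets[OF sets_B_infty])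
  show "(\<Union>n. B_level r n) \<subseteq> Pow (proj_limit r)" by (auto simp: B_level_def)
  show "(\<lambda>x. x \<circ> Suc) \<in> space (B_infty r) \<rightarrow> proj_limit r" by (auto simp: proj_limit_def)
  fix B assume "B \<in> (\<Union>n. B_level r n)"
  then obtain n A where B: "A \<in> sets borel" "B = theta n -` A \<inter> proj_limit r"
    by (auto simp: B_level_def)
  have "(\<lambda>x. x \<circ> Suc) -` B \<inter> space (B_infty r) = theta (Suc n) -` A \<inter> space (B_infty r)"
    by (auto simp: B theta_def proj_limit_def)
  then show "(\<lambda>x. x \<circ> Suc) -` B \<inter> space (B_infty r) \<in> sets (B_infty r)"
    using measurable_sets[OF measurable_theta B(1)] by simp
qed

lemma emeasure_rhat_pullback:
  assumes M: "sets M = sets (B_infty r)" and E: "E \<in> sets M"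
  shows "emeasure (rhat_pullback r M) E = emeasure M (rhat r ` E)"
proof -
  let ?D = "distr M M (\<lambda>x. x \<circ> Suc)"
  have sp: "space M = proj_limit r"
    using sets_eq_imp_space_eq[OF M] by simp
  have meas: "(\<lambda>x. x \<circ> Suc) \<in> measurable M M"
    using measurable_shift measurable_cong_sets[OF M M] by blast
  have eq: "emeasure M (rhat r ` A) = emeasure ?D A" if "A \<in> sets M" for A
    using sets.sets_into_space[OF that] that
    by (simp add: emeasure_distr[OF meas] rhat_image_eq sp)
  have "rhat_pullback r M = measure_of (space M) (sets M) (emeasure ?D)"
    unfolding rhat_pullback_def
    by (rule measure_of_eq) (auto simp: sets.space_closed sets.sigma_sets_eq eq)
  also have "\<dots> = ?D"
    using measure_of_of_measure[of ?D] by simp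
  finally show ?thesis using eq[OF E] by simp
qed

end

theory Submission
  imports Defs
begin

text \<open>
  Composing with \<^term>\<open>rhat r\<close> amounts to pushing forward along its inverse, the shift
  \<open>x \<mapsto> x \<circ> Suc\<close>.  Since the \<open>n\<close>-th coordinate of a shifted point is the coordinate of
  index \<open>n + 1\<close>, the pulled-back measure has the marginals \<open>\<mu>\<^sub>1, \<mu>\<^sub>2, \<dots>\<close>.  The measure
  with density \<open>V \<circ> \<theta>\<^sub>0\<close> also has computable marginals: on the projective limit
  \<open>\<theta>\<^sub>0 = r\<^sup>n \<circ> \<theta>\<^sub>n\<close>, so its \<open>n\<close>-th marginal is \<open>\<mu>\<^sub>n\<close> with density \<open>V \<circ> r\<^sup>n\<close>.

  A finite measure on the projective limit is determined by its marginals, because the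
  cylinder sets form a \<open>\<pi>\<close>-system (\<open>finite_measure_eqI_marginals\<close>).  Hence
  the two measures agree if and only if \<open>\<mu>\<^sub>n\<^sub>+\<^sub>1\<close> has density \<open>V \<circ> r\<^sup>n\<close> with respect to
  \<open>\<mu>\<^sub>n\<close> for all \<open>n\<close> (\<open>rhat_pullback_eq_density_iff\<close>).  The remaining condition
  on \<open>\<mu>\<^sub>0\<close> follows by applying \<open>r\<close> to the case \<open>n = 0\<close>.  By the uniqueness of
  Radon-Nikodym derivatives, agreement of the two measures is the statement about the
  derivative, and testing measures on bounded functions turns it into the integral identities
  (\<open>eq_distr_density_iff_integral\<close>).
\<close>

section \<open>Measures on the projective limit and their marginals\<close>

lemma funpow_theta:
  assumes "x \<in> proj_limit r"
  shows "(r ^^ k) (theta (k + n) x) = theta n x"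
  using assms by (induction k) (auto simp: proj_limit_def theta_def funpow_swap1)

text \<open>Two cylinders over different coordinates can both be written over the larger one, as
  \<open>\<theta>\<^sub>m = r\<^sup>k \<circ> \<theta>\<^sub>k\<^sub>+\<^sub>m\<close>; measurability of \<open>r\<close> keeps the base a Borel set.\<close>

lemma B_level_mono:
  assumes r: "r \<in> borel \<rightarrow>\<^sub>M borel" and "m \<le> n"
  shows "B_level r m \<subseteq> B_level r n"
proof
  fix B assume "B \<in> B_level r m"
  then obtain A where A: "A \<in> sets borel" "B = theta m -` A \<inter> proj_limit r"
    by (auto simp: B_level_def)
  have "(r ^^ (n - m)) -` A \<in> sets borel"
    using measurable_sets[OF measurable_compose_n[OF r] A(1)] by simp
  moreover have "B = theta n -` ((r ^^ (n - m)) -` A) \<inter> proj_limit r"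
    using funpow_theta[of _ r "n - m" m] \<open>m \<le> n\<close> by (auto simp: A)
  ultimately show "B \<in> B_level r n"
    by (auto simp: B_level_def)
qed

lemma Int_stable_cylinders:
  assumes r: "r \<in> borel \<rightarrow>\<^sub>M borel"
  shows "Int_stable (\<Union>n. B_level r n)"
proof (rule Int_stableI)
  fix B C assume "B \<in> (\<Union>n. B_level r n)" "C \<in> (\<Union>n. B_level r n)"
  then obtain m n where "B \<in> B_level r m" "C \<in> B_level r n"
    by auto
  then have "B \<in> B_level r (max m n)" "C \<in> B_level r (max m n)"
    using B_level_mono[OF r, of m "max m n"] B_level_mono[OF r, of n "max m n"] by auto
  then obtain A A' where A: "A \<in> sets borel" "B = theta (max m n) -` A \<inter> proj_limit r"
    and A': "A' \<in> sets borel" "C = theta (max m n) -` A' \<inter> proj_limit r"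
    by (auto simp: B_level_def)
  have "B \<inter> C = theta (max m n) -` (A \<inter> A') \<inter> proj_limit r"
    by (auto simp: A A')
  moreover have "A \<inter> A' \<in> sets borel"
    using A(1) A'(1) by (rule sets.Int)
  ultimately show "B \<inter> C \<in> (\<Union>n. B_level r n)"
    unfolding B_level_def by blast
qed

lemma finite_measure_eqI_marginals:
  assumes r: "r \<in> borel \<rightarrow>\<^sub>M borel"
    and M: "sets M = sets (B_infty r)" and N: "sets N = sets (B_infty r)"
    and fin: "finite_measure M"
    and marginals: "\<And>n. distr M borel (theta n) = distr N borel (theta n)"
  shows "M = N"
proof (rule measure_eqI_generator_eq[OF Int_stable_cylinders[OF r],
      where \<Omega> = "proj_limit r" and A = "\<lambda>_. proj_limit r"])
  have spM: "space M = proj_limit r" and spN: "space N = proj_limit r"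
    using sets_eq_imp_space_eq[OF M] sets_eq_imp_space_eq[OF N] by auto
  have mM: "theta n \<in> M \<rightarrow>\<^sub>M borel" and mN: "theta n \<in> N \<rightarrow>\<^sub>M borel" for n
    using measurable_theta[of n r] measurable_cong_sets[OF M refl] measurable_cong_sets[OF N refl]
    by blast+
  show "(\<Union>n. B_level r n) \<subseteq> Pow (proj_limit r)"
    by (auto simp: B_level_def)
  show "emeasure M B = emeasure N B" if B: "B \<in> (\<Union>n. B_level r n)" for B
  proof -
    obtain n A where A: "A \<in> sets borel" "B = theta n -` A \<inter> proj_limit r"
      using B by (auto simp: B_level_def)
    have "emeasure (distr M borel (theta n)) A = emeasure (distr N borel (theta n)) A"
      by (simp add: marginals)
    then show ?thesis
      by (simp add: emeasure_distr mM mN A spM spN)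
  qed
  show "sets M = sigma_sets (proj_limit r) (\<Union>n. B_level r n)"
    "sets N = sigma_sets (proj_limit r) (\<Union>n. B_level r n)"
    by (simp_all add: M N sets_B_infty)
  show "range (\<lambda>_. proj_limit r) \<subseteq> (\<Union>n. B_level r n)"
    by (auto simp: B_level_def intro!: exI[of _ UNIV])
  show "emeasure M (proj_limit r) \<noteq> \<infinity>"
    using finite_measure.emeasure_finite[OF fin] by simp
qed simp

section \<open>The pulled-back measure and the density\<close>

lemma sets_rhat_pullback [simp]: "sets (rhat_pullback r M) = sets M"
  by (simp add: rhat_pullback_def sets.space_closed sets.sigma_sets_eq)

lemma rhat_pullback_eq_distr:
  assumes M: "sets M = sets (B_infty r)"
  shows "rhat_pullback r M = distr M M (\<lambda>x. x \<circ> Suc)"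
proof (rule measure_eqI)
  fix E assume "E \<in> sets (rhat_pullback r M)"
  then have E: "E \<in> sets M"
    by simp
  have "(\<lambda>x. x \<circ> Suc) \<in> M \<rightarrow>\<^sub>M M"
    using measurable_shift measurable_cong_sets[OF M M] by blast
  moreover have "space M = proj_limit r"
    using sets_eq_imp_space_eq[OF M] by simp
  ultimately show "emeasure (rhat_pullback r M) E = emeasure (distr M M (\<lambda>x. x \<circ> Suc)) E"
    using sets.sets_into_space[OF E] E
    by (simp add: emeasure_rhat_pullback[OF M] emeasure_distr rhat_image_eq)
qed simp

lemma marginal_rhat_pullback:
  assumes M: "sets M = sets (B_infty r)"
  shows "distr (rhat_pullback r M) borel (theta n) = distr M borel (theta (Suc n))"
proof -
  have "(\<lambda>x. x \<circ> Suc) \<in> M \<rightarrow>\<^sub>M M"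
    using measurable_shift measurable_cong_sets[OF M M] by blast
  moreover have "theta n \<in> M \<rightarrow>\<^sub>M borel"
    using measurable_theta[of n r] measurable_cong_sets[OF M refl] by blast
  ultimately have "distr (rhat_pullback r M) borel (theta n) = distr M borel (theta n \<circ> (\<lambda>x. x \<circ> Suc))"
    by (simp add: rhat_pullback_eq_distr[OF M] distr_distr)
  also have "theta n \<circ> (\<lambda>x. x \<circ> Suc) = theta (Suc n)"
    by (simp add: fun_eq_iff theta_def)
  finally show ?thesis .
qed

text \<open>The density depends on \<open>\<theta>\<^sub>0\<close> only, hence on \<open>\<theta>\<^sub>n\<close> through \<open>\<theta>\<^sub>0 = r\<^sup>n \<circ> \<theta>\<^sub>n\<close>,
  and a density that factors through a map can be pushed forward along it.\<close>

lemma marginal_density_theta_0: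
  fixes g :: "'a::topological_space \<Rightarrow> ennreal"
  assumes r: "r \<in> borel \<rightarrow>\<^sub>M borel" and M: "sets M = sets (B_infty r)"
    and g: "g \<in> borel_measurable borel"
  shows "distr (density M (\<lambda>x. g (theta 0 x))) borel (theta n) =
    density (distr M borel (theta n)) (\<lambda>x. g ((r ^^ n) x))"
proof -
  have theta: "theta n \<in> M \<rightarrow>\<^sub>M borel" for n
    using measurable_theta[of n r] measurable_cong_sets[OF M refl] by blast
  have g_rn: "(\<lambda>x. g ((r ^^ n) x)) \<in> borel_measurable borel"
    by (rule measurable_compose[OF measurable_compose_n[OF r] g])
  have "density M (\<lambda>x. g (theta 0 x)) = density M (\<lambda>x. g ((r ^^ n) (theta n x)))"
  proof (rule density_cong)
    show "(\<lambda>x. g (theta 0 x)) \<in> borel_measurable M"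
      by (rule measurable_compose[OF theta g])
    show "(\<lambda>x. g ((r ^^ n) (theta n x))) \<in> borel_measurable M"
      by (rule measurable_compose[OF theta g_rn])
    show "AE x in M. g (theta 0 x) = g ((r ^^ n) (theta n x))"
      using funpow_theta[of _ r n 0] sets_eq_imp_space_eq[OF M] by (intro AE_I2) simp
  qed
  then show ?thesis
    by (simp add: density_distr[OF g_rn theta])
qed

lemma rhat_pullback_eq_density_iff:
  fixes g :: "'a::topological_space \<Rightarrow> ennreal"
  assumes r: "r \<in> borel \<rightarrow>\<^sub>M borel" and M: "sets M = sets (B_infty r)"
    and fin: "finite_measure M" and g: "g \<in> borel_measurable borel"
  shows "rhat_pullback r M = density M (\<lambda>x. g (theta 0 x)) \<longleftrightarrow>
    (\<forall>n. distr M borel (theta (Suc n)) =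
      density (distr M borel (theta n)) (\<lambda>x. g ((r ^^ n) x)))"
    (is "?P = ?D \<longleftrightarrow> (\<forall>n. ?marginals n)")
proof
  assume eq: "?P = ?D"
  show "\<forall>n. ?marginals n"
    using marginal_rhat_pullback[OF M] marginal_density_theta_0[OF r M g] by (simp add: eq)
next
  assume *: "\<forall>n. ?marginals n"
  show "?P = ?D"
  proof (rule finite_measure_eqI_marginals[OF r])
    have "(\<lambda>x. x \<circ> Suc) \<in> M \<rightarrow>\<^sub>M M"
      using measurable_shift measurable_cong_sets[OF M M] by blast
    then show "finite_measure ?P"
      by (simp add: rhat_pullback_eq_distr[OF M] finite_measure.finite_measure_distr[OF fin])
    show "distr ?P borel (theta n) = distr ?D borel (theta n)" for n
      using * by (simp add: marginal_rhat_pullback[OF M] marginal_density_theta_0[OF r M g])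
  qed (simp_all add: M)
qed

section \<open>Reformulations of equality with a density\<close>

lemma (in sigma_finite_measure) eq_density_iff_RN_deriv:
  assumes N: "sets N = sets M" and f: "f \<in> borel_measurable M"
  shows "N = density M f \<longleftrightarrow>
    absolutely_continuous M N \<and> (AE x in M. RN_deriv M N x = f x)"
proof
  assume eq: "N = density M f"
  have "AE x in M. f x = RN_deriv M N x"
    by (rule RN_deriv_unique[OF f]) (simp add: eq)
  then show "absolutely_continuous M N \<and> (AE x in M. RN_deriv M N x = f x)"
    using absolutely_continuousI_density[OF f] by (auto simp: eq)
next
  assume *: "absolutely_continuous M N \<and> (AE x in M. RN_deriv M N x = f x)"
  then have "density M (RN_deriv M N) = density M f"
    using f by (intro density_cong) auto
  then show "N = density M f"
    using density_RN_deriv[OF _ N] * by simp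
qed

text \<open>Indicator functions are bounded, so the integral identities determine \<open>N\<close> on each set.
  The Bochner integral of a non-integrable function is zero; demanding integrability keeps an
  identity of integrals from holding for that reason alone.\<close>

lemma eq_distr_density_iff_integral:
  fixes g :: "'a \<Rightarrow> real" and N :: "'b measure"
  assumes fin: "finite_measure N" and N: "sets N = sets K"
    and T: "T \<in> M \<rightarrow>\<^sub>M K" and g: "g \<in> borel_measurable M" and g_nonneg: "\<And>x. 0 \<le> g x"
  shows "N = distr (density M (\<lambda>x. ennreal (g x))) K T \<longleftrightarrow>
    (\<forall>f :: 'b \<Rightarrow> real. f \<in> borel_measurable K \<longrightarrow> bounded (range f) \<longrightarrow>
      integrable M (\<lambda>x. f (T x) * g x) \<and> (\<integral>x. f x \<partial>N) = (\<integral>x. f (T x) * g x \<partial>M))"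
    (is "_ = ?D \<longleftrightarrow> ?R")
proof
  assume eq: "N = ?D"
  show ?R
  proof (intro allI impI)
    fix f :: "'b \<Rightarrow> real"
    assume f: "f \<in> borel_measurable K" and "bounded (range f)"
    then obtain C where C: "\<And>x. norm (f x) \<le> C"
      by (auto simp: bounded_iff)
    have fN: "f \<in> borel_measurable N"
      using f measurable_cong_sets[OF N refl] by blast
    have T': "T \<in> density M (\<lambda>x. ennreal (g x)) \<rightarrow>\<^sub>M K"
      using T by simp
    have fT: "(\<lambda>x. f (T x)) \<in> borel_measurable M"
      by (rule measurable_compose[OF T f])
    have "integrable N f"
      by (rule finite_measure.integrable_const_bound[OF fin _ fN, of C]) (use C in simp)
    then have "integrable M (\<lambda>x. f (T x) * g x)"
      by (simp add: eq integrable_distr_eq[OF T' f] integrable_density[OF fT g] g_nonneg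
          mult.commute)
    moreover have "(\<integral>x. f x \<partial>N) = (\<integral>x. f (T x) * g x \<partial>M)"
      by (simp add: eq integral_distr[OF T' f] integral_density[OF fT g] g_nonneg mult.commute)
    ultimately show "integrable M (\<lambda>x. f (T x) * g x) \<and>
        (\<integral>x. f x \<partial>N) = (\<integral>x. f (T x) * g x \<partial>M)" ..
  qed
next
  assume R: ?R
  show "N = ?D"
  proof (rule measure_eqI)
    fix A assume A: "A \<in> sets N"
    let ?f = "indicator A :: 'b \<Rightarrow> real"
    have AK: "A \<in> sets K"
      using A N by simp
    have "bounded (range ?f)"
      by (rule boundedI[of _ 1]) (auto simp: indicator_def)
    moreover have "?f \<in> borel_measurable K"
      using AK by simp
    ultimately have int: "integrable M (\<lambda>x. ?f (T x) * g x)"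
      and eq: "(\<integral>x. ?f x \<partial>N) = (\<integral>x. ?f (T x) * g x \<partial>M)"
      using R by blast+
    have "emeasure ?D A = (\<integral>\<^sup>+ x. ennreal (g x) * indicator (T -` A \<inter> space M) x \<partial>M)"
      using AK T g measurable_sets[OF T AK] by (simp add: emeasure_distr emeasure_density)
    also have "\<dots> = (\<integral>\<^sup>+ x. ennreal (?f (T x) * g x) \<partial>M)"
      by (intro nn_integral_cong) (auto simp: indicator_def)
    also have "\<dots> = ennreal (\<integral>x. ?f (T x) * g x \<partial>M)"
      by (intro nn_integral_eq_integral int) (simp add: g_nonneg)
    also have "\<dots> = ennreal (\<integral>x. ?f x \<partial>N)"
      by (simp only: eq)
    also have "\<dots> = emeasure N A"
      using A sets.sets_into_space[OF A]
      by (simp add: finite_measure.emeasure_eq_measure[OF fin] Int_absorb2)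
    finally show "emeasure N A = emeasure ?D A" ..
  qed (simp add: N)
qed

section \<open>The Radon-Nikodym derivative of the pulled-back measure\<close>

theorem theorem3p3:
  fixes r :: "'a::t2_space \<Rightarrow> 'a"
    and \<mu> :: "nat \<Rightarrow> 'a measure"
    and \<mu>hat :: "(nat \<Rightarrow> 'a) measure"
    and V :: "'a \<Rightarrow> real"
  assumes compact_X: "compact (UNIV :: 'a set)"
    and r_measurable: "r \<in> borel \<rightarrow>\<^sub>M borel"
    and r_onto_finite: "\<And>x. finite (r -` {x}) \<and> 1 \<le> card (r -` {x})"
    and r_not_invertible: "\<exists>x. card (r -` {x}) \<noteq> 1"
    and mu_sets: "\<And>n. sets (\<mu> n) = sets borel"
    and mu_finite: "\<And>n. finite_measure (\<mu> n)"
    and mu_compat: "\<And>n. distr (\<mu> (Suc n)) borel r = \<mu> n"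
    and muhat_sets: "sets \<mu>hat = sets (B_infty r)"
    and muhat_finite: "finite_measure \<mu>hat"
    and muhat_marginals: "\<And>n. distr \<mu>hat borel (theta n) = \<mu> n"
    and V_measurable: "V \<in> borel_measurable borel"
    and V_nonneg: "\<And>x. 0 \<le> V x"
  shows
    "((absolutely_continuous \<mu>hat (rhat_pullback r \<mu>hat) \<and>
       (AE x in \<mu>hat. RN_deriv \<mu>hat (rhat_pullback r \<mu>hat) x = ennreal (V (theta 0 x))))
      \<longleftrightarrow>
      (\<mu> 0 = distr (density (\<mu> 0) (\<lambda>x. ennreal (V x))) borel r \<and>
       (\<forall>n. \<mu> (Suc n) = density (\<mu> n) (\<lambda>x. ennreal (V ((r ^^ n) x))))))
     \<and>
     ((absolutely_continuous \<mu>hat (rhat_pullback r \<mu>hat) \<and>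
       (AE x in \<mu>hat. RN_deriv \<mu>hat (rhat_pullback r \<mu>hat) x = ennreal (V (theta 0 x))))
      \<longleftrightarrow>
      (\<forall>f :: 'a \<Rightarrow> real. f \<in> borel_measurable borel \<longrightarrow> bounded (range f) \<longrightarrow>
         (integrable (\<mu> 0) (\<lambda>x. f (r x) * V x) \<and>
          (\<integral>x. f x \<partial>\<mu> 0) = (\<integral>x. f (r x) * V x \<partial>\<mu> 0)) \<and>
         (\<forall>n. integrable (\<mu> n) (\<lambda>x. f x * V ((r ^^ n) x)) \<and>
              (\<integral>x. f x \<partial>\<mu> (Suc n)) = (\<integral>x. f x * V ((r ^^ n) x) \<partial>\<mu> n))))"
proof -
  let ?RN = "absolutely_continuous \<mu>hat (rhat_pullback r \<mu>hat) \<and>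
    (AE x in \<mu>hat. RN_deriv \<mu>hat (rhat_pullback r \<mu>hat) x = ennreal (V (theta 0 x)))"
  let ?base = "\<mu> 0 = distr (density (\<mu> 0) (\<lambda>x. ennreal (V x))) borel r"
  let ?step = "\<lambda>n. \<mu> (Suc n) = density (\<mu> n) (\<lambda>x. ennreal (V ((r ^^ n) x)))"
  have V_ennreal: "(\<lambda>x. ennreal (V x)) \<in> borel_measurable borel"
    using V_measurable by simp
  have "theta 0 \<in> \<mu>hat \<rightarrow>\<^sub>M borel"
    using measurable_theta[of 0 r] measurable_cong_sets[OF muhat_sets refl] by blast
  then have V_theta: "(\<lambda>x. ennreal (V (theta 0 x))) \<in> borel_measurable \<mu>hat"
    by (rule measurable_compose[OF _ V_ennreal])
  interpret muhat: finite_measure \<mu>hat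
    by (rule muhat_finite)
  have "?RN \<longleftrightarrow> rhat_pullback r \<mu>hat = density \<mu>hat (\<lambda>x. ennreal (V (theta 0 x)))"
    using muhat.eq_density_iff_RN_deriv[OF sets_rhat_pullback V_theta] by simp
  also have "\<dots> \<longleftrightarrow> (\<forall>n. ?step n)"
    using rhat_pullback_eq_density_iff[OF r_measurable muhat_sets muhat_finite V_ennreal]
    by (simp add: muhat_marginals)
  finally have RN_iff: "?RN \<longleftrightarrow> (\<forall>n. ?step n)" .
  have base: ?base if "\<forall>n. ?step n"
  proof -
    have "\<mu> 1 = density (\<mu> 0) (\<lambda>x. ennreal (V x))"
      using that[rule_format, of 0] by simp
    then show ?thesis
      using mu_compat[of 0] by simp
  qed
  have first: "?RN \<longleftrightarrow> ?base \<and> (\<forall>n. ?step n)"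
    using RN_iff base by blast
  have r_mu: "r \<in> \<mu> n \<rightarrow>\<^sub>M borel" and V_mu: "V \<in> borel_measurable (\<mu> n)" for n
    using r_measurable V_measurable measurable_cong_sets[OF mu_sets refl] by blast+
  have V_rn: "(\<lambda>x. V ((r ^^ n) x)) \<in> borel_measurable (\<mu> n)" for n
    using measurable_compose[OF measurable_compose_n[OF r_measurable] V_measurable]
      measurable_cong_sets[OF mu_sets refl] by blast
  have id_mu: "(\<lambda>x. x) \<in> \<mu> n \<rightarrow>\<^sub>M borel" for n
    using measurable_ident_sets[OF mu_sets] .
  have base_iff: "?base \<longleftrightarrow>
      (\<forall>f :: 'a \<Rightarrow> real. f \<in> borel_measurable borel \<longrightarrow> bounded (range f) \<longrightarrow>
        integrable (\<mu> 0) (\<lambda>x. f (r x) * V x) \<and>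
        (\<integral>x. f x \<partial>\<mu> 0) = (\<integral>x. f (r x) * V x \<partial>\<mu> 0))"
    by (rule eq_distr_density_iff_integral[OF mu_finite mu_sets r_mu V_mu V_nonneg])
  have step_iff: "?step n \<longleftrightarrow>
      (\<forall>f :: 'a \<Rightarrow> real. f \<in> borel_measurable borel \<longrightarrow> bounded (range f) \<longrightarrow>
        integrable (\<mu> n) (\<lambda>x. f x * V ((r ^^ n) x)) \<and>
        (\<integral>x. f x \<partial>\<mu> (Suc n)) = (\<integral>x. f x * V ((r ^^ n) x) \<partial>\<mu> n))" for n
  proof -
    have "distr (density (\<mu> n) (\<lambda>x. ennreal (V ((r ^^ n) x)))) borel (\<lambda>x. x) =
        density (\<mu> n) (\<lambda>x. ennreal (V ((r ^^ n) x)))"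
      by (rule distr_id2) (simp add: mu_sets)
    then show ?thesis
      using eq_distr_density_iff_integral[OF mu_finite mu_sets id_mu V_rn V_nonneg, of "Suc n" n]
      by simp
  qed
  show ?thesis
    using first unfolding base_iff step_iff by blast
qed

end
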